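(* Let $R$ be a finite commutative ring, $K\le R^\times$, $\mathcal C=\mathrm{Cyc}(K,R)$, $\mathcal A=\mathcal A(K,R)$ its multiplication S-ring, $u=0$ and $v=1$. Then (1) for every $f\in\mathrm{Aut}(\mathcal C_{u,v})$ the set $R^\times$ is $f$-invariant, and the mapping $f\mapsto f^{R^\times}$ (restriction to $R^\times$) is a homomorphism from $\mathrm{Aut}(\mathcal C_{u,v})$ to $\mathrm{Aut}(\mathcal A)$; (2) if $R$ is a field, this mapping is an isomorphism.
   Context: All rings have an identity. A scheme on a finite set $V$ is a pair $(V,\mathcal R)$, $\mathcal R$ a partition of $V\times V$ into nonempty basis relations, closed under transposition, with the diagonal a union of basis relations and with the intersection numbers $|\{y:(x,y)\in R_1,(y,z)\in R_2\}|$ depending only on the basis relation containing $(x,z)$; relations are unions of basis relations. $\mathrm{Aut}$ of a scheme is the group of permutations fixing every basis relation; $\mathrm{Iso}$ is the group of permutations permuting basis relations. For a set $\mathcal M$ of relations, $[\mathcal C,\mathcal M]$ is the smallest scheme having all relations of $\mathcal C$ and of $\mathcal M$ as relations; $\mathcal C_{w}=[\mathcal C,\{(w,w)\}]$, $\mathcal C_{u,v}=[\mathcal C,\{(u,u)\},\{(v,v)\}]$ (so $\mathrm{Aut}(\mathcal C_{u,v})$ is the pointwise stabilizer of $u,v$ in $\mathrm{Aut}(\mathcal C)$). If $\Delta(U)$ is a relation, $\mathcal C_U$ is the scheme on $U$ with basis relations the nonempty $S\cap U^2$. For $\Gamma\le\mathrm{Iso}(\mathcal C)$, $\mathcal C^\Gamma$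 is the scheme whose relations are the $\Gamma$-invariant relations of $\mathcal C$. $\mathrm{Cyc}(K,R)$ is the scheme on $R$ with basis relations $\{(x,y): y-x\in rK\}$, $r\in R$. With $u=0$, $\mathcal C'=((\mathcal C_u)_{R^\times})^{R^\times_{right}}$ where $R^\times_{right}=\{x\mapsto xa:a\in R^\times\}$; its basis relations are of the form $\{(g,xg):g\in R^\times,x\in X\}$, $X\subseteq R^\times$. The multiplication S-ring $\mathcal A(K,R)$ is the S-ring over $R^\times$ (subring of $\mathbb Z[R^\times]$ with $\mathbb Z$-basis the sums over the sets $X$) whose basic sets are these $X$, and $\mathrm{Aut}(\mathcal A)$ is the stabilizer of the point $1$ in $\mathrm{Aut}(\mathcal C')$. *)

theory Defs
  imports Main
begin

text \<open>A scheme on V is given by its set B of basis relations.\<close>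

definition rels :: "('a \<times> 'a) set set \<Rightarrow> ('a \<times> 'a) set set" where
  "rels B = {\<Union> S | S. S \<subseteq> B}"

definition is_scheme :: "'a set \<Rightarrow> ('a \<times> 'a) set set \<Rightarrow> bool" where
  "is_scheme V B \<longleftrightarrow>
     finite V \<and>
     (\<forall>S\<in>B. S \<noteq> {} \<and> S \<subseteq> V \<times> V) \<and>
     \<Union> B = V \<times> V \<and>
     (\<forall>S\<in>B. \<forall>T\<in>B. S \<noteq> T \<longrightarrow> S \<inter> T = {}) \<and>
     (\<forall>S\<in>B. converse S \<in> B) \<and>
     Id_on V \<in> rels B \<and>
     (\<forall>R1\<in>B. \<forall>R2\<in>B. \<forall>S\<in>B. \<forall>x z x' z'. (x, z) \<in> S \<longrightarrow> (x', z') \<in> S \<longrightarrow>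
        card {y. (x, y) \<in> R1 \<and> (y, z) \<in> R2} = card {y. (x', y) \<in> R1 \<and> (y, z') \<in> R2})"

text \<open>[C, M]: the smallest scheme on V having all relations in M as relations.
  (To form [C, M] one passes the basis relations of C together with M.)\<close>

definition scheme_closure :: "'a set \<Rightarrow> ('a \<times> 'a) set set \<Rightarrow> ('a \<times> 'a) set set" where
  "scheme_closure V M = (THE B. is_scheme V B \<and> M \<subseteq> rels B \<and>
      (\<forall>B'. is_scheme V B' \<and> M \<subseteq> rels B' \<longrightarrow> rels B \<subseteq> rels B'))"

definition scheme_restrict :: "('a \<times> 'a) set set \<Rightarrow> 'a set \<Rightarrow> ('a \<times> 'a) set set" where
  "scheme_restrict B U = {S \<inter> (U \<times> U) | S. S \<in> B} - {{}}"

definition pair_img :: "('a \<Rightarrow> 'a) \<Rightarrow> ('a \<times> 'a) set \<Rightarrow> ('a \<times> 'a) set" where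
  "pair_img f T = (\<lambda>(x, y). (f x, f y)) ` T"

definition basis_of :: "('a \<times> 'a) set set \<Rightarrow> ('a \<times> 'a) set set" where
  "basis_of F = {S \<in> F. S \<noteq> {} \<and> (\<forall>T\<in>F. T \<subseteq> S \<longrightarrow> T = {} \<or> T = S)}"

definition scheme_fusion :: "('a \<times> 'a) set set \<Rightarrow> ('a \<Rightarrow> 'a) set \<Rightarrow> ('a \<times> 'a) set set" where
  "scheme_fusion B \<Gamma> = basis_of {T \<in> rels B. \<forall>g\<in>\<Gamma>. pair_img g T = T}"

definition scheme_aut :: "'a set \<Rightarrow> ('a \<times> 'a) set set \<Rightarrow> ('a \<Rightarrow> 'a) set" where
  "scheme_aut V B = {f. bij_betw f V V \<and> (\<forall>x. x \<notin> V \<longrightarrow> f x = x) \<and>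
      (\<forall>S\<in>B. \<forall>x\<in>V. \<forall>y\<in>V. (x, y) \<in> S \<longleftrightarrow> (f x, f y) \<in> S)}"

definition ring_units :: "'a::comm_ring_1 set" where
  "ring_units = {x. x dvd 1}"

definition is_unit_subgroup :: "'a::comm_ring_1 set \<Rightarrow> bool" where
  "is_unit_subgroup K \<longleftrightarrow> K \<subseteq> ring_units \<and> 1 \<in> K \<and>
     (\<forall>x\<in>K. \<forall>y\<in>K. x * y \<in> K) \<and> (\<forall>x\<in>K. \<exists>y\<in>K. x * y = 1)"

definition Cyc :: "'a::comm_ring_1 set \<Rightarrow> ('a \<times> 'a) set set" where
  "Cyc K = {{(x, y). y - x \<in> (\<lambda>k. r * k) ` K} | r. True}"

definition Cyc_01 :: "'a::comm_ring_1 set \<Rightarrow> ('a \<times> 'a) set set" where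
  "Cyc_01 K = scheme_closure UNIV (Cyc K \<union> {{(0, 0)}, {(1, 1)}})"

definition Cyc_0 :: "'a::comm_ring_1 set \<Rightarrow> ('a \<times> 'a) set set" where
  "Cyc_0 K = scheme_closure UNIV (Cyc K \<union> {{(0, 0)}})"

definition right_mults :: "('a::comm_ring_1 \<Rightarrow> 'a) set" where
  "right_mults = {(\<lambda>x. if x \<in> ring_units then x * a else x) | a. a \<in> ring_units}"

definition Cyc_prime :: "'a::comm_ring_1 set \<Rightarrow> ('a \<times> 'a) set set" where
  "Cyc_prime K = scheme_fusion (scheme_restrict (Cyc_0 K) ring_units) right_mults"

definition aut_mult_sring :: "'a::comm_ring_1 set \<Rightarrow> ('a \<Rightarrow> 'a) set" where
  "aut_mult_sring K = {f \<in> scheme_aut ring_units (Cyc_prime K). f 1 = 1}"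

definition restrict_units :: "('a::comm_ring_1 \<Rightarrow> 'a) \<Rightarrow> 'a \<Rightarrow> 'a" where
  "restrict_units f = (\<lambda>x. if x \<in> ring_units then f x else x)"

end

theory Submission
  imports Defs
begin

text \<open>
  Schemes correspond to coherent families of relations, that is, to Boolean algebras of relations
  that are closed under transposition and under counting two-step paths.  These are closed under
  intersection, and the relations invariant under a permutation form one of them.  Hence the
  automorphisms of a closure \<open>[C, M]\<close> are the permutations preserving all generators.

  An automorphism \<open>f\<close> of \<open>Cyc K\<close> that fixes \<open>0\<close> satisfies \<open>f y \<in> yK\<close>, so it preserves the units.
  Conversely, over a field, the relations \<open>{(x, y). y \<in> xsK}\<close> and \<open>{(x, y). y - x \<in> xsK}\<close> on the
  units are relations of \<open>Cyc K\<close> with \<open>0\<close> fixed and are invariant under multiplication, hence are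
  preserved by every \<open>g \<in> Aut(A)\<close>. As \<open>g 1 = 1\<close>, the first ones give \<open>g x \<in> xK\<close>, and
  then the second ones show that \<open>g\<close> preserves \<open>Cyc K\<close>.
\<close>

section \<open>Coherent families of relations\<close>

definition paths :: "('a \<times> 'a) set \<Rightarrow> ('a \<times> 'a) set \<Rightarrow> 'a \<Rightarrow> 'a \<Rightarrow> 'a set" where
  "paths R S x z = {y. (x, y) \<in> R \<and> (y, z) \<in> S}"

text \<open>This axiomatises the set of all relations of a scheme without mentioning basis
  relations. Every condition is a closure condition, so it survives intersection of families, and a
  smallest family containing given generators exists; a partition into basis relations offers no
  such direct argument.\<close>

definition coherent_family :: "'a set \<Rightarrow> ('a \<times> 'a) set set \<Rightarrow> bool" where
  "coherent_family V F \<longleftrightarrow>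
     F \<subseteq> Pow (V \<times> V) \<and> V \<times> V \<in> F \<and> Id_on V \<in> F \<and>
     (\<forall>S\<in>F. \<forall>T\<in>F. S \<union> T \<in> F) \<and>
     (\<forall>S\<in>F. \<forall>T\<in>F. S - T \<in> F) \<and>
     (\<forall>S\<in>F. converse S \<in> F) \<and>
     (\<forall>S\<in>F. \<forall>T\<in>F. \<forall>n. {(x, z) \<in> V \<times> V. card (paths S T x z) = n} \<in> F)"

lemma coherent_familyD:
  assumes "coherent_family V F"
  shows "S \<in> F \<Longrightarrow> S \<subseteq> V \<times> V" "V \<times> V \<in> F" "Id_on V \<in> F" "{} \<in> F"
    "S \<in> F \<Longrightarrow> T \<in> F \<Longrightarrow> S \<union> T \<in> F"
    "S \<in> F \<Longrightarrow> T \<in> F \<Longrightarrow> S - T \<in> F"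
    "S \<in> F \<Longrightarrow> T \<in> F \<Longrightarrow> S \<inter> T \<in> F"
    "S \<in> F \<Longrightarrow> converse S \<in> F"
    "S \<in> F \<Longrightarrow> T \<in> F \<Longrightarrow> {(x, z) \<in> V \<times> V. card (paths S T x z) = n} \<in> F"
proof -
  have sub: "F \<subseteq> Pow (V \<times> V)" and V: "V \<times> V \<in> F" and Id: "Id_on V \<in> F"
    and Un: "\<forall>S\<in>F. \<forall>T\<in>F. S \<union> T \<in> F" and Diff: "\<forall>S\<in>F. \<forall>T\<in>F. S - T \<in> F"
    and conv: "\<forall>S\<in>F. converse S \<in> F"
    and count: "\<forall>S\<in>F. \<forall>T\<in>F. \<forall>n. {(x, z) \<in> V \<times> V. card (paths S T x z) = n} \<in> F"
    using assms unfolding coherent_family_def by - (elim conjE, assumption)+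
  show "S \<in> F \<Longrightarrow> S \<subseteq> V \<times> V"
    using sub by auto
  show "V \<times> V \<in> F" "Id_on V \<in> F"
    by (fact V Id)+
  show "S \<union> T \<in> F" if "S \<in> F" "T \<in> F"
    using Un that by simp
  show diff: "S - T \<in> F" if "S \<in> F" "T \<in> F" for S T
    using Diff that by simp
  show "{} \<in> F"
    using diff[OF V V] by simp
  show "S \<inter> T \<in> F" if "S \<in> F" "T \<in> F"
    using diff[OF that(1) diff[OF that]] by (simp add: Diff_Diff_Int)
  show "converse S \<in> F" if "S \<in> F"
    using conv that by simp
  show "{(x, z) \<in> V \<times> V. card (paths S T x z) = n} \<in> F" if "S \<in> F" "T \<in> F"
    by (rule count[rule_format, OF that])
qed

lemma coherent_family_Union:
  assumes "coherent_family V F" "finite P" "P \<subseteq> F"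
  shows "\<Union> P \<in> F"
  using assms(2,3) by (induction P) (auto intro: coherent_familyD[OF assms(1)])

lemma finite_paths:
  assumes "finite V" "S \<subseteq> V \<times> V"
  shows "finite (paths S T x z)"
  by (rule finite_subset[OF _ assms(1)]) (use assms(2) in \<open>auto simp: paths_def\<close>)

text \<open>The composite is the complement of the level set where the number of two-step paths is
  0. Finiteness of \<open>V\<close> ensures that cardinality 0 really means that no path
  exists.\<close>

lemma coherent_family_relcomp:
  assumes F: "coherent_family V F" and V: "finite V" and S: "S \<in> F" and T: "T \<in> F"
  shows "S O T \<in> F"
proof -
  have sub: "S \<subseteq> V \<times> V" "T \<subseteq> V \<times> V"
    using coherent_familyD(1)[OF F] S T by auto
  have "V \<times> V - {(x, z) \<in> V \<times> V. card (paths S T x z) = 0} = S O T"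
    using sub finite_paths[OF V sub(1)] by (auto simp: paths_def relcomp_unfold)
  moreover have "V \<times> V - {(x, z) \<in> V \<times> V. card (paths S T x z) = 0} \<in> F"
    by (intro coherent_familyD[OF F] S T)
  ultimately show ?thesis
    by simp
qed

lemma coherent_family_Pow: "coherent_family V (Pow (V \<times> V))"
  by (auto simp: coherent_family_def)

lemma coherent_family_Inter:
  assumes "\<F> \<noteq> {}" "\<And>F. F \<in> \<F> \<Longrightarrow> coherent_family V F"
  shows "coherent_family V (\<Inter> \<F>)"
proof -
  have "\<Inter> \<F> \<subseteq> Pow (V \<times> V)"
    using assms coherent_familyD(1) by fastforce
  then show ?thesis
    unfolding coherent_family_def using coherent_familyD[OF assms(2)]
    by simp
qed

section \<open>From schemes to coherent families\<close>

lemma rels_iff_Union: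
  "T \<in> rels B \<longleftrightarrow> T = \<Union> {S \<in> B. S \<subseteq> T}"
proof
  assume "T \<in> rels B"
  then show "T = \<Union> {S \<in> B. S \<subseteq> T}"
    unfolding rels_def by auto
qed (auto simp: rels_def)

lemma subset_rels: "B \<subseteq> rels B"
proof
  fix S assume "S \<in> B"
  then have "S = \<Union> {S}" "{S} \<subseteq> B"
    by auto
  then show "S \<in> rels B"
    unfolding rels_def by blast
qed

lemma rels_Diff:
  assumes disj: "\<And>S T. S \<in> B \<Longrightarrow> T \<in> B \<Longrightarrow> S \<noteq> T \<Longrightarrow> S \<inter> T = {}"
    and "S \<in> rels B" "T \<in> rels B"
  shows "S - T \<in> rels B"
proof -
  obtain P Q where PQ: "P \<subseteq> B" "Q \<subseteq> B" "S = \<Union> P" "T = \<Union> Q"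
    using assms(2,3) unfolding rels_def by auto
  have "S - T = \<Union> (P - Q)"
    unfolding PQ(3,4) using disj PQ(1,2) by blast
  then show ?thesis
    unfolding rels_def using PQ by blast
qed

lemma is_schemeD:
  assumes "is_scheme V B"
  shows "finite V"
    "S \<in> B \<Longrightarrow> S \<noteq> {}"
    "S \<in> B \<Longrightarrow> S \<subseteq> V \<times> V"
    "\<Union> B = V \<times> V"
    "S \<in> B \<Longrightarrow> T \<in> B \<Longrightarrow> S \<noteq> T \<Longrightarrow> S \<inter> T = {}"
    "S \<in> B \<Longrightarrow> converse S \<in> B"
    "Id_on V \<in> rels B"
    "R1 \<in> B \<Longrightarrow> R2 \<in> B \<Longrightarrow> S \<in> B \<Longrightarrow> (x, z) \<in> S \<Longrightarrow> (x', z') \<in> S \<Longrightarrow>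
      card (paths R1 R2 x z) = card (paths R1 R2 x' z')"
proof -
  note scheme = assms[unfolded is_scheme_def, folded paths_def]
  show "finite V"
    using scheme by (elim conjE)
  show "\<Union> B = V \<times> V"
    using scheme by (elim conjE)
  show "Id_on V \<in> rels B"
    using scheme by (elim conjE)
  show "S \<noteq> {}" if "S \<in> B"
    using scheme that by (elim conjE) simp
  show "S \<subseteq> V \<times> V" if "S \<in> B"
    using scheme that by (elim conjE) simp
  show "converse S \<in> B" if "S \<in> B"
    using scheme that by (elim conjE) simp
  show "S \<inter> T = {}" if "S \<in> B" "T \<in> B" "S \<noteq> T"
    using scheme that by (elim conjE) simp
  show "card (paths R1 R2 x z) = card (paths R1 R2 x' z')"
    if "R1 \<in> B" "R2 \<in> B" "S \<in> B" "(x, z) \<in> S" "(x', z') \<in> S"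
    using scheme that by (elim conjE) metis
qed

text \<open>Only the path-counting condition has substance. The number of paths through two unions
  of basis relations is a sum of intersection numbers, hence constant on each basis relation, so its
  level sets are again unions of basis relations.\<close>

lemma coherent_family_rels:
  assumes "is_scheme V B"
  shows "coherent_family V (rels B)"
proof -
  note V = is_schemeD(1)[OF assms] and sub = is_schemeD(3)[OF assms]
    and cover = is_schemeD(4)[OF assms] and disj = is_schemeD(5)[OF assms]
    and conv = is_schemeD(6)[OF assms] and Id = is_schemeD(7)[OF assms]
    and int = is_schemeD(8)[OF assms]
  have finB: "finite B"
    by (rule finite_subset[of _ "Pow (V \<times> V)"]) (use V sub in auto)
  have sub': "S \<subseteq> V \<times> V" if "S \<in> rels B" for S
    using that sub unfolding rels_def by blast
  have count: "{(x, z) \<in> V \<times> V. card (paths S T x z) = n} \<in> rels B" (is "?N \<in> _")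
    if "S \<in> rels B" "T \<in> rels B" for S T n
  proof -
    obtain P Q where PQ: "P \<subseteq> B" "Q \<subseteq> B" "S = \<Union> P" "T = \<Union> Q"
      using \<open>S \<in> rels B\<close> \<open>T \<in> rels B\<close> unfolding rels_def by auto
    have card: "card (paths S T x z) = (\<Sum>(p, q)\<in>P \<times> Q. card (paths p q x z))" for x z
    proof -
      have "paths S T x z = (\<Union>(p, q)\<in>P \<times> Q. paths p q x z)"
        unfolding PQ(3,4) paths_def by auto
      also have "card \<dots> = (\<Sum>pq\<in>P \<times> Q. card (case pq of (p, q) \<Rightarrow> paths p q x z))"
      proof (rule card_UN_disjoint)
        show "finite (P \<times> Q)"
          using PQ finB by (auto intro: finite_subset)
        show "\<forall>i\<in>P \<times> Q. finite (case i of (p, q) \<Rightarrow> paths p q x z)"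
          using PQ(1) finite_paths[OF V sub] by auto
        show "\<forall>i\<in>P \<times> Q. \<forall>j\<in>P \<times> Q. i \<noteq> j \<longrightarrow>
            (case i of (p, q) \<Rightarrow> paths p q x z) \<inter> (case j of (p, q) \<Rightarrow> paths p q x z) = {}"
        \<comment> \<open>Distinct pairs of basis relations differ in one component, and
          disjointness there already excludes a common midpoint \<open>y\<close>.\<close>
        proof (intro ballI impI)
          fix i j assume ij: "i \<in> P \<times> Q" "j \<in> P \<times> Q" "i \<noteq> j"
          moreover from this have "fst i \<noteq> fst j \<or> snd i \<noteq> snd j"
            by (simp add: prod_eq_iff)
          moreover have "fst i \<in> B" "fst j \<in> B" "snd i \<in> B" "snd j \<in> B"
            using ij PQ(1,2) by auto
          ultimately have "fst i \<inter> fst j = {} \<or> snd i \<inter> snd j = {}"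
            using disj by metis
          then show "(case i of (p, q) \<Rightarrow> paths p q x z) \<inter> (case j of (p, q) \<Rightarrow> paths p q x z) = {}"
            unfolding paths_def by (auto simp: case_prod_unfold)
        qed
      qed
      finally show ?thesis
        by (simp add: case_prod_unfold)
    qed
    have const: "card (paths S T x z) = card (paths S T x' z')"
      if "U \<in> B" "(x, z) \<in> U" "(x', z') \<in> U" for U x z x' z'
      unfolding card by (rule sum.cong) (use PQ(1,2) int[OF _ _ that] in auto)
    have "?N \<subseteq> \<Union> {U \<in> B. U \<subseteq> ?N}"
    proof
      fix xz assume xz: "xz \<in> ?N"
      then obtain x z where [simp]: "xz = (x, z)" and "x \<in> V" "z \<in> V" "card (paths S T x z) = n"
        by auto
      then obtain U where U: "U \<in> B" "(x, z) \<in> U"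
        using cover by auto
      have "p \<in> ?N" if "p \<in> U" for p
        using const[OF U, of "fst p" "snd p"] sub[OF U(1)] that \<open>card (paths S T x z) = n\<close>
        by (auto simp: case_prod_unfold)
      then have "U \<subseteq> ?N"
        by (rule subsetI)
      with U show "xz \<in> \<Union> {U \<in> B. U \<subseteq> ?N}"
        by (intro UnionI[of U]) simp_all
    qed
    then show ?thesis
      by (subst rels_iff_Union) blast
  qed
  have "converse S \<in> rels B" if "S \<in> rels B" for S
  proof -
    obtain P where "P \<subseteq> B" "S = \<Union> P"
      using \<open>S \<in> rels B\<close> unfolding rels_def by auto
    then have "converse S = \<Union> (converse ` P)" "converse ` P \<subseteq> B"
      using conv by auto
    then show ?thesis
      unfolding rels_def by blast
  qed
  moreover have "S \<union> T \<in> rels B" if "S \<in> rels B" "T \<in> rels B" for S T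
  proof -
    obtain P Q where "P \<subseteq> B" "Q \<subseteq> B" "S = \<Union> P" "T = \<Union> Q"
      using \<open>S \<in> rels B\<close> \<open>T \<in> rels B\<close> unfolding rels_def by auto
    then have "S \<union> T = \<Union> (P \<union> Q)" "P \<union> Q \<subseteq> B"
      by auto
    then show ?thesis
      unfolding rels_def by blast
  qed
  moreover have "S - T \<in> rels B" if "S \<in> rels B" "T \<in> rels B" for S T
    using rels_Diff[OF _ that] disj by metis
  moreover have "V \<times> V \<in> rels B"
    using cover unfolding rels_def by blast
  moreover have "rels B \<subseteq> Pow (V \<times> V)"
    by (intro subsetI PowI sub')
  ultimately show ?thesis
    unfolding coherent_family_def using Id count
    by (intro conjI ballI allI) simp_all
qed

section \<open>From coherent families to schemes, by atoms\<close>

text \<open>The atom containing \<open>p\<close> is a member of least cardinality containing \<open>p\<close>.\<close>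
lemma obtain_basis_of:
  assumes fin: "\<And>S. S \<in> F \<Longrightarrow> finite S"
    and Diff: "\<And>S T. S \<in> F \<Longrightarrow> T \<in> F \<Longrightarrow> S - T \<in> F"
    and T: "T \<in> F" and p: "p \<in> T"
  obtains S where "S \<in> basis_of F" "p \<in> S" "S \<subseteq> T"
proof -
  obtain S where S: "S \<in> F \<and> p \<in> S"
    and least: "\<And>S'. S' \<in> F \<and> p \<in> S' \<Longrightarrow> card S \<le> card S'"
    using ex_has_least_nat[of "\<lambda>S. S \<in> F \<and> p \<in> S" T card] T p by blast
  have min: "S' = S" if "S' \<in> F" "p \<in> S'" "S' \<subseteq> S" for S'
    using least[of S'] that fin S by (meson card_subset_eq card_mono le_antisym)
  \<comment> \<open>The left side is the intersection of \<open>S\<close> and \<open>T\<close>,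
    written with differences because these are the only operation assumed. It contains
    \<open>p\<close>, so minimality applies.\<close>
  have "S - (S - T) = S"
    using min[of "S - (S - T)"] Diff S T p by blast
  then have ST: "S \<subseteq> T"
    by blast
  have atom: "S' = {} \<or> S' = S" if "S' \<in> F" "S' \<subseteq> S" for S'
  proof (cases "p \<in> S'")
    case True
    then show ?thesis
      using min that by blast
  next
    \<comment> \<open>Now the complement of \<open>S'\<close> in \<open>S\<close> contains
      \<open>p\<close>, so by minimality it is all of \<open>S\<close> and \<open>S'\<close> is
      empty.\<close>
    case False
    then have "S - S' = S"
      using min[of "S - S'"] Diff that S by blast
    then show ?thesis
      using that by blast
  qed
  have "S \<in> basis_of F"
    unfolding basis_of_def using S atom by auto
  then show thesis
    using that[of S] S ST by simp
qed

text \<open>Stated for any difference-closed family of finite relations, so that it applies both to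
  coherent families and to the invariant relations that define a fusion.\<close>

lemma rels_basis_of_supset:
  assumes "\<And>S. S \<in> F \<Longrightarrow> finite S" "\<And>S T. S \<in> F \<Longrightarrow> T \<in> F \<Longrightarrow> S - T \<in> F"
  shows "F \<subseteq> rels (basis_of F)"
proof
  fix T assume T: "T \<in> F"
  have "T \<subseteq> \<Union> {S \<in> basis_of F. S \<subseteq> T}"
    using obtain_basis_of[OF assms T] by blast
  then show "T \<in> rels (basis_of F)"
    by (subst rels_iff_Union) blast
qed

text \<open>An atom that meets a member of the family lies inside it. Applied to the level sets of
  path counts, this makes the intersection numbers constant on atoms; applied to two atoms, it makes
  them equal or disjoint.\<close>

lemma
  assumes F: "coherent_family V F" and V: "finite V"
  shows rels_basis_of: "rels (basis_of F) = F"
    and is_scheme_basis_of: "is_scheme V (basis_of F)"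
proof -
  have fin: "finite S" if "S \<in> F" for S
    using coherent_familyD(1)[OF F that] V by (auto intro: finite_subset)
  have finF: "finite F"
    by (rule finite_subset[of _ "Pow (V \<times> V)"]) (use V coherent_familyD(1)[OF F] in auto)
  have sub: "basis_of F \<subseteq> F"
    unfolding basis_of_def by blast
  show rels: "rels (basis_of F) = F"
  proof
    show "rels (basis_of F) \<subseteq> F"
    proof
      fix T assume "T \<in> rels (basis_of F)"
      then obtain P where "P \<subseteq> F" "T = \<Union> P"
        using sub unfolding rels_def by auto
      then show "T \<in> F"
        using coherent_family_Union[OF F finite_subset[OF _ finF]] by simp
    qed
  qed (rule rels_basis_of_supset[OF fin coherent_familyD(6)[OF F]])
  have within: "S \<subseteq> N" if "S \<in> basis_of F" "N \<in> F" "p \<in> S" "p \<in> N" for S N p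
  proof -
    have "S \<inter> N \<in> F"
      using that sub by (intro coherent_familyD(7)[OF F]) (simp_all add: subsetD)
    then have "S \<inter> N = {} \<or> S \<inter> N = S"
      using that(1) unfolding basis_of_def by blast
    then show ?thesis
      using that by blast
  qed
  have atom_sub: "S \<subseteq> V \<times> V" if "S \<in> basis_of F" for S
    using that sub coherent_familyD(1)[OF F] by (meson subsetD)
  have cover: "\<Union> (basis_of F) = V \<times> V"
  proof
    show "\<Union> (basis_of F) \<subseteq> V \<times> V"
      using atom_sub by (intro Union_least)
    have "V \<times> V \<in> rels (basis_of F)"
      unfolding rels by (rule coherent_familyD(2)[OF F])
    then obtain P where P: "P \<subseteq> basis_of F" "V \<times> V = \<Union> P"
      unfolding rels_def by auto
    show "V \<times> V \<subseteq> \<Union> (basis_of F)"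
      unfolding P(2) by (rule Union_mono[OF P(1)])
  qed
  have conv: "converse S \<in> basis_of F" if "S \<in> basis_of F" for S
  proof -
    have S: "S \<in> F" "S \<noteq> {}" "\<And>T. T \<in> F \<Longrightarrow> T \<subseteq> S \<Longrightarrow> T = {} \<or> T = S"
      using that unfolding basis_of_def by auto
    have "T = {} \<or> T = converse S" if "T \<in> F" "T \<subseteq> converse S" for T
      using S(3)[OF coherent_familyD(8)[OF F that(1)]] that(2) by auto
    then show ?thesis
      using S coherent_familyD(8)[OF F S(1)] unfolding basis_of_def by auto
  qed
  have card: "card (paths R1 R2 x z) = card (paths R1 R2 x' z')"
    if "R1 \<in> basis_of F" "R2 \<in> basis_of F" "S \<in> basis_of F" "(x, z) \<in> S" "(x', z') \<in> S"
    for R1 R2 S x z x' z'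
  proof -
    let ?N = "{(a, c) \<in> V \<times> V. card (paths R1 R2 a c) = card (paths R1 R2 x z)}"
    have "?N \<in> F"
      using that sub by (intro coherent_familyD(9)[OF F]) (simp_all add: subsetD)
    moreover have "(x, z) \<in> ?N"
      using that atom_sub[of S] by auto
    ultimately show ?thesis
      using within[of S ?N "(x, z)"] that by auto
  qed
  have disj: "S = T" if "S \<in> basis_of F" "T \<in> basis_of F" "p \<in> S" "p \<in> T" for S T p
    using within[of S T p] within[of T S p] that sub by (intro equalityI) (simp_all add: subsetD)
  show "is_scheme V (basis_of F)"
    unfolding is_scheme_def rels
  proof (intro conjI ballI allI impI)
    show "S \<noteq> {}" if "S \<in> basis_of F" for S
      using that by (simp add: basis_of_def)
    show "S \<inter> T = {}" if "S \<in> basis_of F" "T \<in> basis_of F" "S \<noteq> T" for S T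
      using disj[OF that(1,2)] that(3) by (simp add: disjoint_iff) metis
  qed (fact V atom_sub cover conv coherent_familyD(3)[OF F] card[unfolded paths_def])+
qed

text \<open>A scheme is recovered from its relations as the set of minimal nonempty ones. This
  yields the uniqueness that the definite description in \<open>scheme_closure\<close>
  requires.\<close>

lemma is_scheme_eq_basis_of:
  assumes "is_scheme V B"
  shows "basis_of (rels B) = B"
proof -
  note ne = is_schemeD(2)[OF assms] and disj = is_schemeD(5)[OF assms]
  have "S \<in> basis_of (rels B)" if S: "S \<in> B" for S
  proof -
    have "T = {} \<or> T = S" if T: "T \<in> rels B" "T \<subseteq> S" for T
    proof -
      obtain P where P: "P \<subseteq> B" "T = \<Union> P"
        using T unfolding rels_def by auto
      have "U = S" if "U \<in> P" for U
        using disj[OF _ S, of U] ne[of U] P T(2) that by auto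
      then show ?thesis
        using P by blast
    qed
    then show ?thesis
      using S ne subset_rels unfolding basis_of_def by blast
  qed
  moreover have "S \<in> B" if S: "S \<in> basis_of (rels B)" for S
  proof -
    have S': "S \<in> rels B" "S \<noteq> {}" "\<And>T. T \<in> rels B \<Longrightarrow> T \<subseteq> S \<Longrightarrow> T = {} \<or> T = S"
      using S unfolding basis_of_def by auto
    then obtain T where "T \<in> B" "T \<subseteq> S"
      unfolding rels_def by blast
    then show ?thesis
      using S'(3)[of T] ne subset_rels by blast
  qed
  ultimately show ?thesis
    by blast
qed

section \<open>The smallest scheme containing given relations\<close>

text \<open>The closure consists of the atoms of the intersection of all coherent families
  containing \<open>M\<close>. The bound on \<open>M\<close> makes the family of all relations on
  \<open>V\<close> one of those intersected.\<close>

lemma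
  assumes V: "finite V" and M: "M \<subseteq> Pow (V \<times> V)"
  shows is_scheme_scheme_closure: "is_scheme V (scheme_closure V M)"
    and generators_subset_rels: "M \<subseteq> rels (scheme_closure V M)"
    and rels_scheme_closure_subset:
      "coherent_family V F' \<Longrightarrow> M \<subseteq> F' \<Longrightarrow> rels (scheme_closure V M) \<subseteq> F'"
proof -
  define F where "F = \<Inter> {F. coherent_family V F \<and> M \<subseteq> F}"
  have F: "coherent_family V F"
    unfolding F_def by (rule coherent_family_Inter) (use M coherent_family_Pow in auto)
  have least: "F \<subseteq> rels B" if "is_scheme V B" "M \<subseteq> rels B" for B
    using coherent_family_rels[OF that(1)] that(2) unfolding F_def by blast
  have MF: "M \<subseteq> F"
    unfolding F_def by blast
  note scheme = is_scheme_basis_of[OF F V] and rels = rels_basis_of[OF F V]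
  have eq: "scheme_closure V M = basis_of F"
    unfolding scheme_closure_def
  proof (rule the_equality)
    show "is_scheme V (basis_of F) \<and> M \<subseteq> rels (basis_of F) \<and>
        (\<forall>B'. is_scheme V B' \<and> M \<subseteq> rels B' \<longrightarrow> rels (basis_of F) \<subseteq> rels B')"
      using scheme MF least by (simp add: rels)
    \<comment> \<open>Two smallest schemes have the same relations, hence the same atoms.\<close>
    fix B assume "is_scheme V B \<and> M \<subseteq> rels B \<and>
        (\<forall>B'. is_scheme V B' \<and> M \<subseteq> rels B' \<longrightarrow> rels B \<subseteq> rels B')"
    then have B: "is_scheme V B" "M \<subseteq> rels B"
      and "M \<subseteq> rels (basis_of F) \<Longrightarrow> rels B \<subseteq> rels (basis_of F)"
      using scheme by simp_all
    then have "rels B = F"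
      using least[OF B] MF rels by simp
    then show "B = basis_of F"
      using is_scheme_eq_basis_of[OF B(1)] by simp
  qed
  show "is_scheme V (scheme_closure V M)" "M \<subseteq> rels (scheme_closure V M)"
    unfolding eq rels using scheme MF by simp_all
  show "coherent_family V F' \<Longrightarrow> M \<subseteq> F' \<Longrightarrow> rels (scheme_closure V M) \<subseteq> F'"
    unfolding eq rels unfolding F_def by blast
qed

section \<open>Automorphisms of a closure\<close>

definition invariant_rels :: "'a set \<Rightarrow> ('a \<Rightarrow> 'a) \<Rightarrow> ('a \<times> 'a) set set" where
  "invariant_rels V f =
     {S. S \<subseteq> V \<times> V \<and> (\<forall>x\<in>V. \<forall>y\<in>V. (x, y) \<in> S \<longleftrightarrow> (f x, f y) \<in> S)}"

text \<open>For invariant \<open>S\<close> and \<open>T\<close>, the bijection \<open>f\<close>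
  carries the midpoints of paths from \<open>x\<close> to \<open>z\<close> onto those from
  \<open>f x\<close> to \<open>f z\<close>, so path counts are invariant as well.\<close>

lemma coherent_family_invariant_rels:
  assumes f: "bij_betw f V V"
  shows "coherent_family V (invariant_rels V f)"
proof -
  have fV: "f x \<in> V" if "x \<in> V" for x
    using bij_betwE[OF f] that by blast
  have inj: "inj_on f V"
    using f bij_betw_imp_inj_on by blast
  have count: "card (paths S T x z) = card (paths S T (f x) (f z))"
    if S: "S \<in> invariant_rels V f" and T: "T \<in> invariant_rels V f"
      and xz: "x \<in> V" "z \<in> V" for S T x z
  proof (rule bij_betw_same_card)
    have sub: "paths S T a c \<subseteq> V" for a c
      using S unfolding paths_def invariant_rels_def by blast
    have "f ` paths S T x z = paths S T (f x) (f z)"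
    proof (intro equalityI subsetI)
      fix y assume "y \<in> f ` paths S T x z"
      then show "y \<in> paths S T (f x) (f z)"
        using S T xz sub unfolding paths_def invariant_rels_def by blast
    next
      fix y assume y: "y \<in> paths S T (f x) (f z)"
      then obtain y' where "y' \<in> V" "y = f y'"
        using sub f unfolding bij_betw_def by blast
      then show "y \<in> f ` paths S T x z"
        using S T xz y unfolding paths_def invariant_rels_def by blast
    qed
    then show "bij_betw f (paths S T x z) (paths S T (f x) (f z))"
      using inj_on_subset[OF inj sub] unfolding bij_betw_def by simp
  qed
  have "{(x, z) \<in> V \<times> V. card (paths S T x z) = n} \<in> invariant_rels V f"
    if "S \<in> invariant_rels V f" "T \<in> invariant_rels V f" for S T n
    unfolding invariant_rels_def using count[OF that] fV by auto
  moreover have "Id_on V \<in> invariant_rels V f"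
    unfolding invariant_rels_def using fV by (auto dest: inj_onD[OF inj])
  moreover have "V \<times> V \<in> invariant_rels V f"
    unfolding invariant_rels_def using fV by auto
  moreover have "S \<union> T \<in> invariant_rels V f" "S - T \<in> invariant_rels V f"
    "converse S \<in> invariant_rels V f"
    if "S \<in> invariant_rels V f" "T \<in> invariant_rels V f" for S T
    using that by (auto simp: invariant_rels_def)
  moreover have "invariant_rels V f \<subseteq> Pow (V \<times> V)"
    by (auto simp: invariant_rels_def)
  ultimately show ?thesis
    unfolding coherent_family_def by (intro conjI ballI allI) simp_all
qed

lemma scheme_aut_rels:
  assumes "f \<in> scheme_aut V B" "S \<in> rels B" "x \<in> V" "y \<in> V"
  shows "(x, y) \<in> S \<longleftrightarrow> (f x, f y) \<in> S"
  using assms unfolding scheme_aut_def rels_def by blast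

lemma scheme_aut_antimono:
  assumes "N \<subseteq> M"
  shows "scheme_aut V M \<subseteq> scheme_aut V N"
proof
  fix f assume f: "f \<in> scheme_aut V M"
  note rel = scheme_aut_rels[OF f subsetD[OF subset_rels]]
  show "f \<in> scheme_aut V N"
    unfolding scheme_aut_def
  proof (intro CollectI conjI ballI)
    show "bij_betw f V V" "\<forall>x. x \<notin> V \<longrightarrow> f x = x"
      using f unfolding scheme_aut_def by simp_all
    fix S x y assume "S \<in> N" "x \<in> V" "y \<in> V"
    then show "(x, y) \<in> S \<longleftrightarrow> (f x, f y) \<in> S"
      using rel[of S x y] assms by (simp add: subsetD)
  qed
qed

text \<open>If \<open>f\<close> preserves the generators, its invariant relations form a coherent
  family containing \<open>M\<close>, hence contain the whole closure. Automorphisms of a closure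
  can thus be tested without knowing its basis relations.\<close>

lemma scheme_aut_scheme_closure_iff:
  assumes "finite V" "M \<subseteq> Pow (V \<times> V)"
  shows "f \<in> scheme_aut V (scheme_closure V M) \<longleftrightarrow> f \<in> scheme_aut V M"
proof
  assume f: "f \<in> scheme_aut V (scheme_closure V M)"
  show "f \<in> scheme_aut V M"
    using f scheme_aut_rels[OF f] generators_subset_rels[OF assms]
    unfolding scheme_aut_def by blast
next
  assume f: "f \<in> scheme_aut V M"
  then have "M \<subseteq> invariant_rels V f" "bij_betw f V V"
    using assms(2) unfolding invariant_rels_def scheme_aut_def by blast+
  then have "scheme_closure V M \<subseteq> invariant_rels V f"
    using rels_scheme_closure_subset[OF assms coherent_family_invariant_rels] subset_rels
    by blast
  then show "f \<in> scheme_aut V (scheme_closure V M)"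
    using f unfolding scheme_aut_def invariant_rels_def by blast
qed

section \<open>Restriction to a subset and fusion under right multiplications\<close>

lemma rels_scheme_restrict:
  "rels (scheme_restrict B U) = {S \<inter> (U \<times> U) | S. S \<in> rels B}" (is "?L = ?R")
proof (intro equalityI subsetI)
  fix T assume "T \<in> ?L"
  then obtain P where P: "P \<subseteq> scheme_restrict B U" "T = \<Union> P"
    unfolding rels_def by auto
  define Q where "Q = {S \<in> B. S \<inter> (U \<times> U) \<in> P}"
  have "T = \<Union> Q \<inter> (U \<times> U)"
  proof (intro equalityI subsetI)
    fix p assume "p \<in> T"
    then obtain S' where "S' \<in> P" "p \<in> S'"
      using P by auto
    moreover then obtain S where "S \<in> B" "S' = S \<inter> (U \<times> U)"
      using P unfolding scheme_restrict_def by auto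
    ultimately show "p \<in> \<Union> Q \<inter> (U \<times> U)"
      unfolding Q_def by auto
  qed (use P in \<open>auto simp: Q_def\<close>)
  moreover have "\<Union> Q \<in> rels B"
    unfolding rels_def Q_def by blast
  ultimately show "T \<in> ?R"
    by blast
next
  fix T assume "T \<in> ?R"
  then obtain P where P: "P \<subseteq> B" "T = \<Union> P \<inter> (U \<times> U)"
    unfolding rels_def by auto
  then have "T = \<Union> ((\<lambda>S. S \<inter> (U \<times> U)) ` P - {{}})"
    by auto
  moreover have "(\<lambda>S. S \<inter> (U \<times> U)) ` P - {{}} \<subseteq> scheme_restrict B U"
    using P unfolding scheme_restrict_def by auto
  ultimately show "T \<in> ?L"
    unfolding rels_def by blast
qed

lemma inj_pair_img:
  assumes "inj g"
  shows "inj (\<lambda>(x, y). (g x, g y))"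
  using assms by (auto simp: inj_on_def)

lemma ring_units_mult: "a \<in> ring_units \<Longrightarrow> b \<in> ring_units \<Longrightarrow> a * b \<in> ring_units"
  unfolding ring_units_def using mult_dvd_mono[of a 1 b 1] by simp

lemma ring_units_cancel:
  assumes "a \<in> ring_units" "x * a = y * a"
  shows "x = y"
proof -
  obtain b where b: "1 = a * b"
    using assms(1) unfolding ring_units_def dvd_def by auto
  have "x = (x * a) * b" "y = (y * a) * b"
    using b by (simp_all add: mult.assoc flip: b)
  then show ?thesis
    using assms(2) by simp
qed

text \<open>Multiplication by a unit is injective on the units and keeps them among themselves,
  while nonunits stay fixed; so the two pieces cannot collide.\<close>

lemma inj_right_mults:
  assumes "g \<in> right_mults"
  shows "inj g"
proof (rule injI)
  obtain a where a: "a \<in> ring_units" "g = (\<lambda>x. if x \<in> ring_units then x * a else x)"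
    using assms unfolding right_mults_def by auto
  fix x y assume "g x = g y"
  then show "x = y"
    using ring_units_mult[OF _ a(1)] ring_units_cancel[OF a(1)] unfolding a(2)
    by (cases "x \<in> ring_units"; cases "y \<in> ring_units") auto
qed

text \<open>This shows that every automorphism of the fusion preserves each invariant relation.
  Injectivity makes images commute with differences, so the invariant relations are
  difference-closed and decompose into atoms.\<close>

lemma rels_subset_rels_scheme_fusion:
  fixes B :: "('a::finite \<times> 'a) set set"
  assumes disj: "\<And>S T. S \<in> B \<Longrightarrow> T \<in> B \<Longrightarrow> S \<noteq> T \<Longrightarrow> S \<inter> T = {}"
    and "\<And>g. g \<in> \<Gamma> \<Longrightarrow> inj g"
  shows "{T \<in> rels B. \<forall>g\<in>\<Gamma>. pair_img g T = T} \<subseteq> rels (scheme_fusion B \<Gamma>)"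
  unfolding scheme_fusion_def
proof (rule rels_basis_of_supset)
  fix S T assume "S \<in> {T \<in> rels B. \<forall>g\<in>\<Gamma>. pair_img g T = T}"
    and "T \<in> {T \<in> rels B. \<forall>g\<in>\<Gamma>. pair_img g T = T}"
  then show "S - T \<in> {T \<in> rels B. \<forall>g\<in>\<Gamma>. pair_img g T = T}"
    using rels_Diff[OF disj] assms(2)
    by (auto simp: pair_img_def image_set_diff[OF inj_pair_img])
qed simp

section \<open>Cosets of \<open>K\<close> and the cyclotomic scheme\<close>

definition cyc_rel :: "'a::comm_ring_1 set \<Rightarrow> 'a \<Rightarrow> ('a \<times> 'a) set" where
  "cyc_rel K r = {(x, y). y - x \<in> (*) r ` K}"

lemma Cyc_eq: "Cyc K = range (cyc_rel K)"
  unfolding Cyc_def cyc_rel_def by auto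

text \<open>Writing \<open>z = x * k\<close>, the factor \<open>k\<close> is absorbed by
  \<open>K\<close>. The extra factor \<open>s\<close> serves relations whose coset label
  \<open>x * s\<close> moves with the point \<open>x\<close>.\<close>

lemma coset_eq:
  assumes K: "is_unit_subgroup K" and z: "z \<in> (*) x ` K"
  shows "(*) (z * s) ` K = (*) (x * s) ` K"
proof -
  obtain k where k: "k \<in> K" "z = x * k"
    using z by auto
  obtain l where l: "l \<in> K" "k * l = 1"
    using K k unfolding is_unit_subgroup_def by blast
  have mult: "a * b \<in> K" if "a \<in> K" "b \<in> K" for a b
    using K that unfolding is_unit_subgroup_def by blast
  have "z * s * a = x * s * (k * a)" for a
    by (simp add: k(2) ac_simps)
  moreover have "x * s * a = z * s * (l * a)" for a
  proof -
    have "z * s * (l * a) = x * s * a * (k * l)"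
      by (simp only: k(2) ac_simps)
    then show ?thesis
      by (simp add: l(2))
  qed
  ultimately show ?thesis
    using mult[OF k(1)] mult[OF l(1)] by (intro equalityI image_subsetI) auto
qed

lemma mem_coset_self: "is_unit_subgroup K \<Longrightarrow> x \<in> (*) x ` K"
  unfolding is_unit_subgroup_def by force

lemma mem_coset_iff:
  assumes K: "is_unit_subgroup K" and z: "z \<in> (*) x ` K"
  shows "z \<in> (*) r ` K \<longleftrightarrow> x \<in> (*) r ` K"
  using coset_eq[OF K, of _ _ 1] mem_coset_self[OF K] z by (metis mult.right_neutral)

text \<open>It suffices to look at the generators of the closure. For a bijection, preserving the
  singleton \<open>{(0, 0)}\<close> amounts to fixing 0, and likewise for 1.\<close>

lemma scheme_aut_Cyc_01_iff:
  fixes K :: "'a::{finite, comm_ring_1} set"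
  shows "f \<in> scheme_aut UNIV (Cyc_01 K) \<longleftrightarrow>
    bij f \<and> f 0 = 0 \<and> f 1 = 1 \<and> (\<forall>r x y. (x, y) \<in> cyc_rel K r \<longleftrightarrow> (f x, f y) \<in> cyc_rel K r)"
  unfolding Cyc_01_def
  by (subst scheme_aut_scheme_closure_iff) (auto simp: scheme_aut_def Cyc_eq, (metis bij_pointE)+)

lemma scheme_aut_Cyc_01_subset:
  fixes K :: "'a::{finite, comm_ring_1} set"
  shows "scheme_aut UNIV (Cyc_01 K) \<subseteq> scheme_aut UNIV (Cyc_0 K)"
proof
  fix f assume "f \<in> scheme_aut UNIV (Cyc_01 K)"
  then have "f \<in> scheme_aut UNIV (Cyc K \<union> {{(0, 0)}, {(1, 1)}})"
    unfolding Cyc_01_def by (subst (asm) scheme_aut_scheme_closure_iff) simp_all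
  then have "f \<in> scheme_aut UNIV (Cyc K \<union> {{(0, 0)}})"
    by (rule subsetD[OF scheme_aut_antimono, rotated]) auto
  then show "f \<in> scheme_aut UNIV (Cyc_0 K)"
    unfolding Cyc_0_def by (subst scheme_aut_scheme_closure_iff) simp_all
qed

section \<open>Relations of the cyclotomic scheme with 0 fixed\<close>

lemma coherent_family_rels_Cyc_0:
  "coherent_family UNIV (rels (Cyc_0 (K :: 'a::{finite, comm_ring_1} set)))"
  unfolding Cyc_0_def by (intro coherent_family_rels is_scheme_scheme_closure) auto

lemma
  fixes K :: "'a::{finite, comm_ring_1} set"
  shows cyc_rel_mem_rels_Cyc_0: "cyc_rel K r \<in> rels (Cyc_0 K)"
    and zero_mem_rels_Cyc_0: "{(0, 0)} \<in> rels (Cyc_0 K)"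
  using generators_subset_rels[of "UNIV :: 'a set" "Cyc K \<union> {{(0, 0)}}"]
  unfolding Cyc_0_def Cyc_eq by auto

text \<open>The coset of \<open>r\<close> is the set of out-neighbours of 0 under
  \<open>cyc_rel K r\<close>. Composing the converse with the fixed point 0 and then with the full
  relation selects these points and leaves the second coordinate free.\<close>

lemma rels_Cyc_0_coset:
  fixes K :: "'a::{finite, comm_ring_1} set"
  shows "{(x, y). x \<in> (*) r ` K} \<in> rels (Cyc_0 K)"
proof -
  note F = coherent_family_rels_Cyc_0[of K]
  have "UNIV \<in> rels (Cyc_0 K)"
    using coherent_familyD(2)[OF F] by simp
  then have "converse (cyc_rel K r) O ({(0 :: 'a, 0 :: 'a)} O UNIV) \<in> rels (Cyc_0 K)"
    by (intro coherent_family_relcomp[OF F] coherent_familyD(8)[OF F]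
        cyc_rel_mem_rels_Cyc_0 zero_mem_rels_Cyc_0 finite)
  moreover have "{(x, y). x \<in> (*) r ` K} = converse (cyc_rel K r) O ({(0 :: 'a, 0 :: 'a)} O UNIV)"
    unfolding cyc_rel_def by (auto simp: relcomp_unfold)
  ultimately show ?thesis
    by metis
qed

text \<open>A gluing principle: over the strip where \<open>x\<close> lies in the coset of
  \<open>r\<close>, use the relation \<open>G r\<close>. Since \<open>G\<close> depends only on the
  coset, the finitely many pieces fit together into a relation whose label varies with
  \<open>x\<close>.\<close>

lemma rels_Cyc_0_of_cosets:
  fixes K :: "'a::{finite, comm_ring_1} set"
  assumes K: "is_unit_subgroup K" and G: "\<And>r. G r \<in> rels (Cyc_0 K)"
    and cong: "\<And>x r. x \<in> (*) r ` K \<Longrightarrow> G x = G r"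
  shows "{(x, y). (x, y) \<in> G x} \<in> rels (Cyc_0 K)"
proof -
  note F = coherent_family_rels_Cyc_0[of K]
  have "{(x, y). (x, y) \<in> G x} = (\<Union>r. {(x, y). x \<in> (*) r ` K} \<inter> G r)"
  proof (intro equalityI subsetI)
    fix p assume "p \<in> {(x, y). (x, y) \<in> G x}"
    then show "p \<in> (\<Union>r. {(x, y). x \<in> (*) r ` K} \<inter> G r)"
      using mem_coset_self[OF K] by (intro UN_I[of "fst p"]) auto
  next
    fix p assume "p \<in> (\<Union>r. {(x, y). x \<in> (*) r ` K} \<inter> G r)"
    then obtain r where "fst p \<in> (*) r ` K" "p \<in> G r"
      unfolding UN_iff Int_iff mem_Collect_eq case_prod_unfold by blast
    then show "p \<in> {(x, y). (x, y) \<in> G x}"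
      using cong[of "fst p" r] by (auto simp: case_prod_unfold)
  qed
  also have "\<dots> \<in> rels (Cyc_0 K)"
    by (rule coherent_family_Union[OF F])
      (use coherent_familyD(7)[OF F rels_Cyc_0_coset G] in auto)
  finally show "{(x, y). (x, y) \<in> G x} \<in> rels (Cyc_0 K)" .
qed

lemma rels_Cyc_prime:
  fixes K :: "'a::{finite, comm_ring_1} set"
  assumes S: "S \<in> rels (Cyc_0 K)"
    and mult: "\<And>x y a. a \<in> ring_units \<Longrightarrow> (x, y) \<in> S \<Longrightarrow> (x * a, y * a) \<in> S"
  shows "S \<inter> (ring_units \<times> ring_units) \<in> rels (Cyc_prime K)"
proof -
  let ?S = "S \<inter> (ring_units \<times> ring_units)"
  have "is_scheme UNIV (Cyc_0 K)"
    unfolding Cyc_0_def by (intro is_scheme_scheme_closure) auto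
  then have disj: "S \<inter> T = {}"
    if "S \<in> scheme_restrict (Cyc_0 K) ring_units" "T \<in> scheme_restrict (Cyc_0 K) ring_units"
      "S \<noteq> T" for S T
    using that is_schemeD(5) unfolding scheme_restrict_def by blast
  have "pair_img g ?S = ?S" if g: "g \<in> right_mults" for g
    unfolding pair_img_def
  \<comment> \<open>The hypothesis gives only that the image is contained in the relation;
    injectivity and finiteness upgrade this to equality.\<close>
  proof (rule endo_inj_surj)
    show "(\<lambda>(x, y). (g x, g y)) ` ?S \<subseteq> ?S"
      using g mult ring_units_mult unfolding right_mults_def by auto
    show "inj_on (\<lambda>(x, y). (g x, g y)) ?S"
      by (rule inj_on_subset[OF inj_pair_img[OF inj_right_mults[OF g]]]) simp
  qed simp
  moreover have "?S \<in> rels (scheme_restrict (Cyc_0 K) ring_units)"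
    using S unfolding rels_scheme_restrict by blast
  ultimately show ?thesis
    unfolding Cyc_prime_def
    using rels_subset_rels_scheme_fusion[OF disj inj_right_mults] by blast
qed

section \<open>Restricting automorphisms to the units\<close>

text \<open>The pair \<open>(0, y)\<close> lies in \<open>cyc_rel K y\<close>, and \<open>f\<close>
  fixes 0.\<close>

lemma scheme_aut_mem_coset:
  fixes K :: "'a::{finite, comm_ring_1} set"
  assumes K: "is_unit_subgroup K" and f: "f \<in> scheme_aut UNIV (Cyc_01 K)"
  shows "f y \<in> (*) y ` K"
proof -
  have "(0, y) \<in> cyc_rel K y"
    using mem_coset_self[OF K] by (simp add: cyc_rel_def)
  then have "(f 0, f y) \<in> cyc_rel K y"
    using f unfolding scheme_aut_Cyc_01_iff by blast
  then show ?thesis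
    using f unfolding scheme_aut_Cyc_01_iff by (simp add: cyc_rel_def)
qed

lemma scheme_aut_image_ring_units:
  fixes K :: "'a::{finite, comm_ring_1} set"
  assumes K: "is_unit_subgroup K" and f: "f \<in> scheme_aut UNIV (Cyc_01 K)"
  shows "f ` ring_units = ring_units"
proof (rule endo_inj_surj)
  show "f ` ring_units \<subseteq> ring_units"
  proof (rule image_subsetI)
    fix y :: 'a assume "y \<in> ring_units"
    moreover obtain k where "k \<in> K" "f y = y * k"
      using scheme_aut_mem_coset[OF K f, of y] by auto
    ultimately show "f y \<in> ring_units"
      using K ring_units_mult unfolding is_unit_subgroup_def by auto
  qed
  show "inj_on f ring_units"
    using f inj_on_subset[of f UNIV] unfolding scheme_aut_Cyc_01_iff bij_def by simp
qed simp

text \<open>Basis relations of \<open>Cyc_prime K\<close> are traces on the units of relations of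
  \<open>Cyc_0 K\<close>. These are preserved by \<open>f\<close>, which also maps the units onto
  themselves.\<close>

lemma restrict_units_mem_aut_mult_sring:
  fixes K :: "'a::{finite, comm_ring_1} set"
  assumes K: "is_unit_subgroup K" and f: "f \<in> scheme_aut UNIV (Cyc_01 K)"
  shows "restrict_units f \<in> aut_mult_sring K"
proof -
  have one: "1 \<in> ring_units"
    by (simp add: ring_units_def)
  have "inj_on f ring_units"
    using f inj_on_subset[of f UNIV] unfolding scheme_aut_Cyc_01_iff bij_def by simp
  then have "bij_betw f ring_units ring_units"
    using scheme_aut_image_ring_units[OF K f] by (simp add: bij_betw_def)
  then have bij: "bij_betw (restrict_units f) ring_units ring_units"
    by (simp add: restrict_units_def cong: bij_betw_cong)
  have f0: "f \<in> scheme_aut UNIV (Cyc_0 K)"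
    using f scheme_aut_Cyc_01_subset by blast
  have "(x, y) \<in> S \<longleftrightarrow> (f x, f y) \<in> S"
    if S: "S \<in> Cyc_prime K" and xy: "x \<in> ring_units" "y \<in> ring_units" for S x y
  proof -
    have "S \<in> rels (scheme_restrict (Cyc_0 K) ring_units)"
      using S by (simp add: Cyc_prime_def scheme_fusion_def basis_of_def)
    then obtain T where T: "T \<in> rels (Cyc_0 K)" "S = T \<inter> (ring_units \<times> ring_units)"
      unfolding rels_scheme_restrict by blast
    have "f x \<in> ring_units" "f y \<in> ring_units"
      using scheme_aut_image_ring_units[OF K f] xy by blast+
    then show ?thesis
      using scheme_aut_rels[OF f0 T(1)] xy T(2) by simp
  qed
  moreover have "f 1 = 1"
    using f unfolding scheme_aut_Cyc_01_iff by blast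
  ultimately show ?thesis
    using bij one by (simp add: aut_mult_sring_def scheme_aut_def restrict_units_def)
qed

section \<open>Automorphisms of the multiplication S-ring\<close>

lemma aut_mult_sring_rels:
  fixes K :: "'a::{finite, comm_ring_1} set"
  assumes g: "g \<in> aut_mult_sring K" and S: "S \<in> rels (Cyc_0 K)"
    and mult: "\<And>x y a. a \<in> ring_units \<Longrightarrow> (x, y) \<in> S \<Longrightarrow> (x * a, y * a) \<in> S"
    and xy: "x \<in> ring_units" "y \<in> ring_units"
  shows "(x, y) \<in> S \<longleftrightarrow> (g x, g y) \<in> S"
proof -
  have aut: "g \<in> scheme_aut ring_units (Cyc_prime K)"
    using g by (simp add: aut_mult_sring_def)
  then have "g x \<in> ring_units" "g y \<in> ring_units"
    using xy by (auto simp: scheme_aut_def dest: bij_betwE)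
  then show ?thesis
    using scheme_aut_rels[OF aut rels_Cyc_prime[OF S mult]] xy by simp
qed

text \<open>For fixed \<open>y\<close>, the relation between \<open>x\<close> and the coset of
  \<open>x * y\<close> is invariant under multiplication and contains \<open>(1, y)\<close>. Since
  \<open>g 1 = 1\<close>, its image pair places \<open>g y\<close> in the coset of
  \<open>y\<close>.\<close>

lemma aut_mult_sring_mem_coset:
  fixes K :: "'a::{finite, comm_ring_1} set"
  assumes K: "is_unit_subgroup K" and g: "g \<in> aut_mult_sring K" and y: "y \<in> ring_units"
  shows "g y \<in> (*) y ` K"
proof -
  let ?G = "\<lambda>r. {(x, z). z \<in> (*) (r * y) ` K}"
  have F: "coherent_family UNIV (rels (Cyc_0 K))"
    by (rule coherent_family_rels_Cyc_0)
  have eq: "?G r = converse {(z, x). z \<in> (*) (r * y) ` K}" for r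
    by auto
  have "?G r \<in> rels (Cyc_0 K)" for r
    unfolding eq by (rule coherent_familyD(8)[OF F rels_Cyc_0_coset])
  then have "{(x, z). (x, z) \<in> ?G x} \<in> rels (Cyc_0 K)"
    by (rule rels_Cyc_0_of_cosets[OF K]) (simp add: coset_eq[OF K])
  then have "{(x, z). z \<in> (*) (x * y) ` K} \<in> rels (Cyc_0 K)"
    by simp
  then have "(1, y) \<in> {(x, z). z \<in> (*) (x * y) ` K} \<longleftrightarrow>
      (g 1, g y) \<in> {(x, z). z \<in> (*) (x * y) ` K}"
    by (rule aut_mult_sring_rels[OF g]) (use y in \<open>auto simp: ring_units_def ac_simps\<close>)
  then show ?thesis
    using g mem_coset_self[OF K, of y] by (simp add: aut_mult_sring_def)
qed

text \<open>Multiplication by a unit generally changes the label of \<open>cyc_rel K r\<close>.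
  Letting the label move with the first point, as \<open>x * s\<close>, restores invariance; the
  label at \<open>g x\<close> then agrees with that at \<open>x\<close>, because \<open>g x\<close>
  lies in the coset of \<open>x\<close>.\<close>

lemma aut_mult_sring_cyc_rel:
  fixes K :: "'a::{finite, comm_ring_1} set"
  assumes K: "is_unit_subgroup K" and g: "g \<in> aut_mult_sring K"
    and xy: "x \<in> ring_units" "y \<in> ring_units"
  shows "(x, y) \<in> cyc_rel K r \<longleftrightarrow> (g x, g y) \<in> cyc_rel K r"
proof -
  obtain b where b: "1 = x * b"
    using xy(1) unfolding ring_units_def dvd_def by auto
  \<comment> \<open>As \<open>b\<close> inverts \<open>x\<close>, this is the quotient of
    \<open>r\<close> by \<open>x\<close>, so the moving label equals \<open>r\<close> at the given
    point.\<close>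
  define s where "s = b * r"
  have r: "r = x * s"
    unfolding s_def by (simp flip: mult.assoc b)
  let ?S = "{(x, y). (x, y) \<in> cyc_rel K (x * s)}"
  have "?S \<in> rels (Cyc_0 K)"
    by (rule rels_Cyc_0_of_cosets[OF K cyc_rel_mem_rels_Cyc_0])
      (simp add: cyc_rel_def coset_eq[OF K])
  moreover have "(x * a, y * a) \<in> ?S" if "(x, y) \<in> ?S" for x y a
  proof -
    obtain k where "k \<in> K" "y - x = x * s * k"
      using \<open>(x, y) \<in> ?S\<close> unfolding cyc_rel_def by auto
    then have "y * a - x * a = x * a * s * k"
      using left_diff_distrib[of y x a] by (simp add: ac_simps)
    then show ?thesis
      using \<open>k \<in> K\<close> by (simp add: cyc_rel_def)
  qed
  ultimately have "(x, y) \<in> ?S \<longleftrightarrow> (g x, g y) \<in> ?S"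
    using aut_mult_sring_rels[OF g _ _ xy] by blast
  then show ?thesis
    using coset_eq[OF K aut_mult_sring_mem_coset[OF K g xy(1)], of s] by (simp add: r cyc_rel_def)
qed

text \<open>In a field 0 is the only nonunit. Pairs of units are settled by the previous lemma, and
  a pair involving 0 only asks for the coset of the other point, up to sign, which \<open>g\<close>
  preserves.\<close>

lemma aut_mult_sring_subset_scheme_aut:
  fixes K :: "'a::{finite, comm_ring_1} set"
  assumes K: "is_unit_subgroup K" and field: "\<And>x::'a. x \<noteq> 0 \<Longrightarrow> x dvd 1"
  shows "aut_mult_sring K \<subseteq> scheme_aut UNIV (Cyc_01 K)"
proof
  fix g assume g: "g \<in> aut_mult_sring K"
  have units: "(ring_units :: 'a set) = - {0}"
    using field by (auto simp: ring_units_def)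
  \<comment> \<open>\<open>g\<close> is the identity off the units, so it fixes 0.\<close>
  have g0: "g 0 = 0" and g1: "g 1 = 1" and bij: "bij_betw g (- {0}) (- {0})"
    using g by (auto simp: aut_mult_sring_def scheme_aut_def units)
  have "bij_betw g (- {0} \<union> {0}) (- {0} \<union> {0})"
    by (rule bij_betw_combine[OF bij]) (auto simp: g0 bij_betw_def)
  moreover have "- {0 :: 'a} \<union> {0} = UNIV"
    by auto
  ultimately have "bij g"
    by metis
  moreover have "(x, y) \<in> cyc_rel K r \<longleftrightarrow> (g x, g y) \<in> cyc_rel K r" for x y r
  proof -
    have mem: "g z \<in> (*) z ` K" for z
      using aut_mult_sring_mem_coset[OF K g, of z] mem_coset_self[OF K, of 0]
      by (cases "z = 0") (auto simp: units g0)
    \<comment> \<open>For \<open>y = 0\<close> the difference is \<open>- x\<close>; the sign is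
      moved into the label, since \<open>g\<close> is known to respect the coset of \<open>x\<close>
      itself.\<close>
    have neg: "- z \<in> (*) r ` K \<longleftrightarrow> z \<in> (*) (- r) ` K" for z
      by (simp add: image_iff minus_equation_iff[of z]) metis
    consider "x = 0" | "y = 0" | "x \<in> ring_units" "y \<in> ring_units"
      using units by auto
    then show ?thesis
    proof cases
      case 1
      then show ?thesis
        using mem_coset_iff[OF K mem] by (simp add: cyc_rel_def g0)
    next
      case 2
      then show ?thesis
        using mem_coset_iff[OF K mem, of x "- r"] neg[of x] neg[of "g x"]
        by (simp add: cyc_rel_def g0)
    next
      case 3
      then show ?thesis
        by (rule aut_mult_sring_cyc_rel[OF K g])
    qed
  qed
  ultimately show "g \<in> scheme_aut UNIV (Cyc_01 K)"
    using g0 g1 by (simp add: scheme_aut_Cyc_01_iff)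
qed

section \<open>The restriction map as a homomorphism and, for fields, an isomorphism\<close>

theorem theorem4p3:
  fixes K :: "'a::{finite, comm_ring_1} set"
  assumes "is_unit_subgroup K"
  shows "(\<forall>f\<in>scheme_aut UNIV (Cyc_01 K). f ` ring_units = ring_units)
       \<and> (\<forall>f\<in>scheme_aut UNIV (Cyc_01 K). restrict_units f \<in> aut_mult_sring K)
       \<and> (\<forall>f\<in>scheme_aut UNIV (Cyc_01 K). \<forall>g\<in>scheme_aut UNIV (Cyc_01 K).
            restrict_units (f \<circ> g) = restrict_units f \<circ> restrict_units g)
       \<and> ((\<forall>x::'a. x \<noteq> 0 \<longrightarrow> x dvd 1) \<longrightarrow>
            bij_betw restrict_units (scheme_aut UNIV (Cyc_01 K)) (aut_mult_sring K))"
proof (intro conjI ballI impI)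
  note K = assms
  show "f ` ring_units = ring_units" if "f \<in> scheme_aut UNIV (Cyc_01 K)" for f
    by (rule scheme_aut_image_ring_units[OF K that])
  show mem: "restrict_units f \<in> aut_mult_sring K" if "f \<in> scheme_aut UNIV (Cyc_01 K)" for f
    by (rule restrict_units_mem_aut_mult_sring[OF K that])
  show "restrict_units (f \<circ> g) = restrict_units f \<circ> restrict_units g"
    if "g \<in> scheme_aut UNIV (Cyc_01 K)" for f g
    \<comment> \<open>On a unit \<open>x\<close> the value \<open>g x\<close> is again a unit, so
      the outer restriction acts there as \<open>f\<close>; off the units both sides are the
      identity.\<close>
    using scheme_aut_image_ring_units[OF K that]
    by (auto simp: restrict_units_def fun_eq_iff)
  assume field: "\<forall>x::'a. x \<noteq> 0 \<longrightarrow> x dvd 1"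
  show "bij_betw restrict_units (scheme_aut UNIV (Cyc_01 K)) (aut_mult_sring K)"
    unfolding bij_betw_def
  proof (intro conjI equalityI)
    show "inj_on restrict_units (scheme_aut UNIV (Cyc_01 K))"
    proof (intro inj_onI ext)
      fix f g x
      assume f: "f \<in> scheme_aut UNIV (Cyc_01 K)" and g: "g \<in> scheme_aut UNIV (Cyc_01 K)"
        and eq: "restrict_units f = restrict_units g"
      show "f x = g x"
      proof (cases "x = 0")
        case True
        then show ?thesis
          using f g by (simp add: scheme_aut_Cyc_01_iff)
      next
        case False
        then have "x \<in> ring_units"
          using field by (simp add: ring_units_def)
        then show ?thesis
          using fun_cong[OF eq, of x] by (simp add: restrict_units_def)
      qed
    qed
    show "restrict_units ` scheme_aut UNIV (Cyc_01 K) \<subseteq> aut_mult_sring K"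
      using mem by blast
    show "aut_mult_sring K \<subseteq> restrict_units ` scheme_aut UNIV (Cyc_01 K)"
    proof
      \<comment> \<open>Surjectivity: \<open>g\<close> is its own preimage, being already the
        identity off the units and an automorphism of the full scheme.\<close>
      fix g assume g: "g \<in> aut_mult_sring K"
      then have "restrict_units g = g"
        by (auto simp: restrict_units_def aut_mult_sring_def scheme_aut_def)
      then show "g \<in> restrict_units ` scheme_aut UNIV (Cyc_01 K)"
        using aut_mult_sring_subset_scheme_aut[OF K] field g by (metis image_eqI subsetD)
    qed
  qed
qed

end
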